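(* Let $r \geq 1$ be arbitrary, let $D$ be the $r$-neighborhood of $\vec{0}$ in the king grid, and assume that $a \neq b$. Then any $(D,b,a)$-covering is two-periodic. In other words, all $(r,b,a)$-coverings in the king grid are two-periodic whenever $a \neq b$.
   Context: The king grid is the graph with vertex set $\mathbb{Z}^2$ in which two distinct vertices $\vec{u},\vec{v}$ are adjacent if and only if $\vec{u}-\vec{v} \in \{(\pm1,0),(0,\pm1),(\pm1,\pm1)\}$. The (closed) $r$-neighborhood $N_r(\vec{u})$ of a vertex $\vec{u}$ is the set of vertices at graph distance at most $r$ from $\vec{u}$. For a finite shape $D \subseteq \mathbb{Z}^2$ and non-negative integers $b,a$, a configuration $c \in \{0,1\}^{\mathbb{Z}^2}$ is a $(D,b,a)$-covering if for every $\vec{u} \in \mathbb{Z}^2$ the pattern $c|_{\vec{u}+D}$ contains exactly $b$ symbols $1$ when $c_{\vec{u}}=1$ and exactly $a$ symbols $1$ when $c_{\vec{u}}=0$. Equivalently, a code $S \subseteq \mathbb{Z}^2$ is an $(r,b,a)$-covering in the king grid if $|N_r(\vec{u}) \cap S| = b$ for $\vec{u} \in S$ and $= a$ for $\vec{u} \notin S$; this holds iff the indicator configuration of $S$ is a $(D,b,a)$-covering with $D = N_r(\vec{0})$. A configuration (or code) is two-periodic if it is invariant under translation by two linearly independent vectors of $\mathbb{Z}^2$. *)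

theory Defs
  imports
    "HOL-Analysis.Analysis"
    "Graph_Theory.Pair_Digraph"
    "Graph_Theory.Shortest_Path"
begin

definition king_grid :: "(int \<times> int) pair_pre_digraph" where
  "king_grid = \<lparr> pverts = UNIV,
     parcs = {(u, v). u \<noteq> v \<and>
       u - v \<in> {(1, 0), (-1, 0), (0, 1), (0, -1), (1, 1), (1, -1), (-1, 1), (-1, -1)}} \<rparr>"

lemma wf_digraph_king_grid: "wf_digraph (with_proj king_grid)"
  by unfold_locales (auto simp: king_grid_def)

text \<open>With unit arc weights, the infimum \<^const>\<open>wf_digraph.\<mu>\<close> of the walk costs is the
  graph distance.\<close>

definition king_dist :: "int \<times> int \<Rightarrow> int \<times> int \<Rightarrow> ereal" where
  "king_dist u v = wf_digraph.\<mu> (with_proj king_grid) (\<lambda>_. 1) u v"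

definition king_nbhd :: "nat \<Rightarrow> int \<times> int \<Rightarrow> (int \<times> int) set" where
  "king_nbhd r u = {v. king_dist u v \<le> ereal (real r)}"

text \<open>The next definition is meant for finite \<open>D\<close> only: \<^const>\<open>card\<close> is \<open>0\<close> on infinite sets.\<close>

definition covering :: "(int \<times> int) set \<Rightarrow> nat \<Rightarrow> nat \<Rightarrow> (int \<times> int \<Rightarrow> nat) \<Rightarrow> bool" where
  "covering D b a c \<longleftrightarrow>
     (\<forall>u. c u \<in> {0, 1}) \<and>
     (\<forall>u. (c u = 1 \<longrightarrow> card {v \<in> (\<lambda>d. u + d) ` D. c v = 1} = b) \<and>
          (c u = 0 \<longrightarrow> card {v \<in> (\<lambda>d. u + d) ` D. c v = 1} = a))"

definition king_code_covering :: "nat \<Rightarrow> nat \<Rightarrow> nat \<Rightarrow> (int \<times> int) set \<Rightarrow> bool" where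
  "king_code_covering r b a S \<longleftrightarrow>
     (\<forall>u. (u \<in> S \<longrightarrow> card (king_nbhd r u \<inter> S) = b) \<and>
          (u \<notin> S \<longrightarrow> card (king_nbhd r u \<inter> S) = a))"

text \<open>Linear independence is stated after embedding the integer vectors into the real plane.
  The condition \<open>p \<noteq> q\<close> is needed because \<open>{p, q}\<close> collapses to a singleton otherwise.\<close>

definition lin_indep_pair :: "int \<times> int \<Rightarrow> int \<times> int \<Rightarrow> bool" where
  "lin_indep_pair p q \<longleftrightarrow> p \<noteq> q \<and>
     independent {map_prod real_of_int real_of_int p, map_prod real_of_int real_of_int q}"

definition two_periodic :: "(int \<times> int \<Rightarrow> nat) \<Rightarrow> bool" where
  "two_periodic c \<longleftrightarrow>
     (\<exists>p q. lin_indep_pair p q \<and> (\<forall>u. c (u + p) = c u) \<and> (\<forall>u. c (u + q) = c u))"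

definition two_periodic_code :: "(int \<times> int) set \<Rightarrow> bool" where
  "two_periodic_code S \<longleftrightarrow>
     (\<exists>p q. lin_indep_pair p q \<and> (\<lambda>u. u + p) ` S = S \<and> (\<lambda>u. u + q) ` S = S)"

end

theory Submission
  imports Defs "HOL-Library.Poly_Mapping" "HOL-Computational_Algebra.Primes"
begin

text \<open>
  Let \<open>c\<close> be the indicator function and \<open>k = b - a\<close>. In the group ring of \<open>\<int>\<^sup>2\<close>, the polynomial
  \<open>f = (\<Sum>v\<in>D. X\<^sup>v) - k\<close> maps \<open>c\<close> to a constant, hence annihilates \<open>g = (X\<^sup>e - 1) c\<close> for
  \<open>e = (1, 0)\<close>. Modulo a prime \<open>p\<close>, \<open>f\<^sup>p\<close> is \<open>f(X\<^sup>p)\<close>, so for large \<open>p\<close> the values of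
  \<open>f(X\<^sup>p) g\<close>, being small and divisible by \<open>p\<close>, vanish. Therefore \<open>f(X\<^sup>n)\<close> annihilates \<open>g\<close> for all \<open>n\<close> in an arithmetic progression, and eliminating the
  monomials one by one yields an annihilator \<open>\<Prod>(X\<^sup>w - 1)\<close> of \<open>g\<close> with all \<open>w \<noteq> 0\<close>.

  Each factor can be replaced by a horizontal one: a bounded \<open>w\<close>-periodic function annihilated by \<open>f\<close>
  is determined by its values on finitely many points, so by the pigeonhole principle it has a
  horizontal period. Boundedness turns a product of horizontal differences into a single
  one. The vertical period follows by symmetry.
\<close>

subsection \<open>Dilation of the covering equation\<close>

text \<open>By \<open>king_nbhd_eq\<close>, the ball of radius \<open>r\<close> about the origin in
  coordinates.\<close>

definition king_box :: "nat \<Rightarrow> (int \<times> int) set" where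
  "king_box r = {- int r..int r} \<times> {- int r..int r}"

definition scl :: "int \<Rightarrow> int \<times> int \<Rightarrow> int \<times> int" where
  "scl n v = (n * fst v, n * snd v)"

text \<open>The action of the dilated polynomial f(X^n). The coefficient \<open>- k\<close> sits at
  exponent 0, which dilation fixes.\<close>

definition box_op :: "nat \<Rightarrow> int \<Rightarrow> int \<Rightarrow> (int \<times> int \<Rightarrow> int) \<Rightarrow> int \<times> int \<Rightarrow> int" where
  "box_op r k n g u = (\<Sum>v\<in>king_box r. g (u + scl n v)) - k * g u"

text \<open>Finitely supported functions under convolution model the group ring; \<open>act\<close>
  is its module structure on integer-valued functions by translation.\<close>

definition act :: "(int \<times> int \<Rightarrow>\<^sub>0 int) \<Rightarrow> (int \<times> int \<Rightarrow> int) \<Rightarrow> int \<times> int \<Rightarrow> int" where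
  "act P g u = (\<Sum>v\<in>Poly_Mapping.keys P. Poly_Mapping.lookup P v * g (u + v))"

lemma finite_king_box [simp]: "finite (king_box r)"
  by (simp add: king_box_def)

lemma act_superset:
  assumes "finite S" "Poly_Mapping.keys P \<subseteq> S"
  shows "act P g u = (\<Sum>v\<in>S. Poly_Mapping.lookup P v * g (u + v))"
  unfolding act_def using assms by (intro sum.mono_neutral_left) (auto simp: in_keys_iff)

lemma act_0 [simp]: "act 0 g u = 0"
  by (simp add: act_def)

lemma act_add: "act (P + Q) g u = act P g u + act Q g u"
proof -
  let ?S = "Poly_Mapping.keys P \<union> Poly_Mapping.keys Q"
  have "Poly_Mapping.keys (P + Q) \<subseteq> ?S" by (rule keys_add)
  then show ?thesis
    by (simp add: act_superset[of ?S] lookup_add distrib_right sum.distrib)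
qed

lemma act_sum: "act (sum F A) g u = (\<Sum>x\<in>A. act (F x) g u)"
  by (induction A rule: infinite_finite_induct) (auto simp: act_add)

lemma act_single [simp]: "act (Poly_Mapping.single v x) g u = x * g (u + v)"
  by (subst act_superset[of "{v}"]) auto

lemma poly_mapping_eq_sum_single:
  "P = (\<Sum>v\<in>Poly_Mapping.keys P. Poly_Mapping.single v (Poly_Mapping.lookup P v))"
proof (rule poly_mapping_eqI)
  fix w
  have "(\<Sum>v\<in>Poly_Mapping.keys P. Poly_Mapping.lookup P v when v = w) = Poly_Mapping.lookup P w"
  proof (cases "w \<in> Poly_Mapping.keys P")
    case True
    then have "(\<Sum>v\<in>Poly_Mapping.keys P. Poly_Mapping.lookup P v when v = w)
      = (\<Sum>v\<in>{w}. Poly_Mapping.lookup P v when v = w)"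
      by (intro sum.mono_neutral_right) (auto simp: when_def)
    then show ?thesis by simp
  next
    case False
    then have "(\<Sum>v\<in>Poly_Mapping.keys P. Poly_Mapping.lookup P v when v = w) = 0"
      by (intro sum.neutral) (auto simp: when_def)
    with False show ?thesis by (simp add: in_keys_iff)
  qed
  then show "Poly_Mapping.lookup P w = Poly_Mapping.lookup
      (\<Sum>v\<in>Poly_Mapping.keys P. Poly_Mapping.single v (Poly_Mapping.lookup P v)) w"
    by (simp add: lookup_sum lookup_single)
qed

text \<open>With convolution turned into composition, every multiple of an annihilator is an
  annihilator.\<close>

lemma act_mult: "act (P * Q) g u = act P (act Q g) u"
proof -
  define lp where "lp = Poly_Mapping.lookup P"
  define lq where "lq = Poly_Mapping.lookup Q"
  have "P * Q = (\<Sum>v\<in>Poly_Mapping.keys P. Poly_Mapping.single v (lp v))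
      * (\<Sum>w\<in>Poly_Mapping.keys Q. Poly_Mapping.single w (lq w))"
    unfolding lp_def lq_def using poly_mapping_eq_sum_single[of P] poly_mapping_eq_sum_single[of Q]
    by simp
  also have "\<dots> = (\<Sum>v\<in>Poly_Mapping.keys P. \<Sum>w\<in>Poly_Mapping.keys Q.
      Poly_Mapping.single (v + w) (lp v * lq w))"
    by (simp add: sum_product mult_single)
  finally show ?thesis
    by (simp add: act_sum act_def[of P] act_def[of Q] lp_def lq_def sum_distrib_left
        add.assoc mult.assoc)
qed

section \<open>Congruences modulo a prime in the group ring\<close>

lemma act_of_nat_mult: "act (of_nat p * P) g u = int p * act P g u"
proof -
  have "act (of_nat p) g u = int p * g u" for g :: "int \<times> int \<Rightarrow> int" and u
    by (simp flip: single_of_nat)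
  then show ?thesis by (simp add: act_mult)
qed

text \<open>All inner binomial coefficients are multiples of \<open>p\<close>. The congruence is
  phrased as divisibility by \<open>of_nat p\<close> since the group ring has characteristic 0;
  \<open>act_of_nat_mult\<close> later turns it into divisibility of integers.\<close>

lemma dvd_freshmans_dream:
  fixes x y :: "'a :: comm_ring_1"
  assumes "prime p"
  shows "of_nat p dvd (x + y) ^ p - (x ^ p + y ^ p)"
proof -
  have p: "p > 0" using assms by (simp add: prime_gt_0_nat)
  let ?t = "\<lambda>k. of_nat (p choose k) * x ^ k * y ^ (p - k)"
  have "(x + y) ^ p = (\<Sum>k\<le>p. ?t k)" by (rule binomial_ring)
  also have "\<dots> = (\<Sum>k\<in>{0, p}. ?t k) + (\<Sum>k\<in>{..p} - {0, p}. ?t k)"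
    by (subst sum.subset_diff[of "{0, p}"]) (auto simp: add.commute)
  also have "(\<Sum>k\<in>{0, p}. ?t k) = x ^ p + y ^ p"
    using p by (simp add: add.commute)
  finally have "(x + y) ^ p - (x ^ p + y ^ p) = (\<Sum>k\<in>{..p} - {0, p}. ?t k)" by simp
  moreover have "of_nat p dvd (\<Sum>k\<in>{..p} - {0, p}. ?t k)"
  proof (rule dvd_sum)
    fix k assume "k \<in> {..p} - {0, p}"
    then have "p dvd (p choose k)"
      by (intro dvd_choose_prime) (use assms in auto)
    then show "of_nat p dvd ?t k"
      by (metis dvd_mult2 of_nat_dvd_iff of_nat_mult dvd_def)
  qed
  ultimately show ?thesis by simp
qed

lemma dvd_freshmans_dream_sum:
  fixes f :: "'b \<Rightarrow> 'a :: comm_ring_1"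
  assumes "prime p"
  shows "of_nat p dvd (sum f A) ^ p - (\<Sum>x\<in>A. f x ^ p)"
proof (induction A rule: infinite_finite_induct)
  case (insert x A)
  have "(sum f (insert x A)) ^ p - (\<Sum>x\<in>insert x A. f x ^ p)
     = ((f x + sum f A) ^ p - (f x ^ p + (sum f A) ^ p)) + ((sum f A) ^ p - (\<Sum>x\<in>A. f x ^ p))"
    using insert by simp
  then show ?case using dvd_add[OF dvd_freshmans_dream[OF assms] insert.IH] by metis
qed (use assms in \<open>auto simp: prime_gt_0_nat zero_power\<close>)

text \<open>Fermat's little theorem: \<open>k\<close> is a sum of copies of \<open>sgn k\<close>, to
  which the freshman's dream applies. Oddness of \<open>p\<close> gives
  \<open>sgn k ^ p = sgn k\<close>.\<close>

lemma prime_dvd_power_minus_self: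
  fixes k :: int
  assumes "prime p" "odd p"
  shows "int p dvd k ^ p - k"
proof -
  have "sgn k ^ p = sgn k"
    using assms by (auto simp: sgn_if prime_gt_0_nat)
  then show ?thesis
    using dvd_freshmans_dream_sum[OF assms(1), of "\<lambda>_. sgn k" "{..<nat \<bar>k\<bar>}"]
    by (simp add: abs_mult_sgn)
qed

definition box_poly :: "nat \<Rightarrow> int \<Rightarrow> int \<Rightarrow> (int \<times> int \<Rightarrow>\<^sub>0 int)" where
  "box_poly r k n = (\<Sum>v\<in>king_box r. Poly_Mapping.single (scl n v) 1) + Poly_Mapping.single 0 (- k)"

lemma act_box_poly: "act (box_poly r k n) g u = box_op r k n g u"
  by (simp add: box_poly_def box_op_def act_add act_sum)

lemma single_power:
  "Poly_Mapping.single v x ^ m = Poly_Mapping.single (scl (int m) v) (x ^ m)"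
proof (induction m)
  case 0
  then show ?case by (simp add: scl_def flip: zero_prod_def)
next
  case (Suc m)
  have "v + scl (int m) v = scl (int (Suc m)) v"
    by (simp add: scl_def prod_eq_iff algebra_simps)
  with Suc show ?case by (simp add: mult_single)
qed

text \<open>Frobenius multiplies the exponents by \<open>p\<close>, and Fermat preserves the
  coefficient \<open>- k\<close> modulo \<open>p\<close>.\<close>

lemma box_poly_power:
  assumes "prime p" "odd p"
  shows "of_nat p dvd box_poly r k n ^ p - box_poly r k (int p * n)"
proof -
  define S :: "int \<times> int \<Rightarrow>\<^sub>0 int" where "S = (\<Sum>v\<in>king_box r. Poly_Mapping.single (scl n v) 1)"
  define K :: "int \<times> int \<Rightarrow>\<^sub>0 int" where "K = Poly_Mapping.single 0 (- k)"
  define S' :: "int \<times> int \<Rightarrow>\<^sub>0 int"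
    where "S' = (\<Sum>v\<in>king_box r. Poly_Mapping.single (scl (int p * n) v) 1)"
  have "scl (int p) (scl n v) = scl (int p * n) v" for v
    by (simp add: scl_def)
  then have 1: "of_nat p dvd S ^ p - S'"
    using dvd_freshmans_dream_sum[OF assms(1), of "\<lambda>v. Poly_Mapping.single (scl n v) (1::int)" "king_box r"]
    by (simp add: S_def S'_def single_power)
  have "int p dvd (- k) ^ p - (- k)" by (rule prime_dvd_power_minus_self[OF assms])
  then obtain m where m: "(- k) ^ p = - k + int p * m" by (metis diff_eq_eq dvdE add.commute)
  have "scl (int p) 0 = 0" by (simp add: scl_def zero_prod_def)
  then have "K ^ p - K = of_nat p * Poly_Mapping.single 0 m"
    by (simp add: K_def single_power m mult_single flip: single_of_nat single_diff)
  then have 2: "of_nat p dvd K ^ p - K" by simp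
  have "box_poly r k n ^ p - box_poly r k (int p * n)
    = ((S + K) ^ p - (S ^ p + K ^ p)) + (S ^ p - S') + (K ^ p - K)"
    by (simp add: box_poly_def S_def S'_def K_def)
  then show ?thesis
    using 1 2 dvd_freshmans_dream[OF assms(1), of S K] by (metis dvd_add)
qed

text \<open>The bound is independent of \<open>n\<close>, so one threshold for the primes serves
  every dilation.\<close>

lemma abs_box_op_le:
  assumes "\<And>u. \<bar>g u\<bar> \<le> B"
  shows "\<bar>box_op r k n g u\<bar> \<le> (int (card (king_box r)) + \<bar>k\<bar>) * B"
proof -
  have "\<bar>\<Sum>v\<in>king_box r. g (u + scl n v)\<bar> \<le> (\<Sum>v\<in>king_box r. B)"
    by (rule order_trans[OF sum_abs sum_mono]) (rule assms)
  moreover have "\<bar>k * g u\<bar> \<le> \<bar>k\<bar> * B"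
    by (simp add: abs_mult mult_left_mono assms)
  ultimately show ?thesis
    unfolding box_op_def by (simp add: distrib_right)
qed

text \<open>The \<open>p\<close>-th power of an annihilator annihilates, so the new value is
  \<open>p\<close> times an integer; being smaller than \<open>p\<close> in absolute value, it is
  0.\<close>

lemma box_op_prime_mult:
  assumes p: "prime p" "odd p" and B: "\<And>u. \<bar>g u\<bar> \<le> B"
    and large: "int p > (int (card (king_box r)) + \<bar>k\<bar>) * B"
    and zero: "\<And>u. box_op r k n g u = 0"
  shows "box_op r k (int p * n) g u = 0"
proof -
  obtain H where "box_poly r k n ^ p - box_poly r k (int p * n) = of_nat p * H"
    using box_poly_power[OF p] by (rule dvdE)
  then have H: "box_poly r k n ^ p = box_poly r k (int p * n) + of_nat p * H"
    by (simp add: algebra_simps)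
  have "box_poly r k n ^ p = box_poly r k n ^ (p - 1) * box_poly r k n"
    using prime_gt_0_nat[OF p(1)] by (metis power_minus_mult)
  moreover have "act (box_poly r k n) g = (\<lambda>_. 0)"
    using zero by (auto simp: act_box_poly)
  ultimately have "act (box_poly r k n ^ p) g u = 0"
    by (simp only: act_mult) (simp add: act_def)
  then have "box_op r k (int p * n) g u = int p * - act H g u"
    by (simp add: H act_add act_of_nat_mult act_box_poly)
  then have "int p dvd box_op r k (int p * n) g u" by simp
  moreover have "\<bar>box_op r k (int p * n) g u\<bar> < int p"
    using abs_box_op_le[OF B] large by (rule order_le_less_trans)
  ultimately show ?thesis
    by (metis abs_of_nat dvd_imp_le_int linorder_not_le)
qed

text \<open>The prime factors of \<open>m\<close> are multiplied in one at a time;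
  \<open>N \<ge> 2\<close> makes them odd.\<close>

lemma box_op_dilate:
  fixes N m :: nat
  assumes B: "\<And>u. \<bar>g u\<bar> \<le> B"
    and N: "int N \<ge> (int (card (king_box r)) + \<bar>k\<bar>) * B" "N \<ge> 2"
    and zero: "\<And>u. box_op r k 1 g u = 0"
    and m: "m > 0" "\<And>p. prime p \<Longrightarrow> p dvd m \<Longrightarrow> p > N"
  shows "box_op r k (int m) g u = 0"
  using m
proof (induction m arbitrary: u rule: less_induct)
  case (less m)
  show ?case
  proof (cases "m = 1")
    case True
    then show ?thesis using zero by simp
  next
    case False
    then obtain p where p: "prime p" "p dvd m" using prime_factor_nat by blast
    then obtain q where q: "m = p * q" by blast
    have gt: "p > N" using p less.prems by blast
    have "odd p" using p gt N(2) prime_odd_nat by auto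
    have "q < m" "q > 0" using q less.prems(1) gt N(2) by auto
    then have "box_op r k (int q) g u = 0" for u
      using less.IH less.prems(2) q by simp
    then have "box_op r k (int p * int q) g u = 0"
      by (intro box_op_prime_mult[OF p(1) \<open>odd p\<close> B]) (use gt N(1) in auto)
    then show ?thesis by (simp add: q)
  qed
qed

text \<open>Supplies an arithmetic progression of dilations without prime factors up to
  \<open>N\<close>.\<close>

lemma prime_dvd_Suc_mult_fact:
  assumes "prime p" "p dvd 1 + j * fact N"
  shows "p > N"
proof (rule ccontr)
  assume "\<not> p > N"
  then have "p dvd fact N" using assms(1) by (simp add: prime_dvd_fact_iff)
  then have "p dvd 1" using assms(2) by (metis dvd_add_left_iff dvd_mult)
  then show False using assms(1) by simp
qed

subsection \<open>Annihilation by a product of differences\<close>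

text \<open>The action of X^w - 1, so \<open>foldr diff ws\<close> is the action of a product of
  such factors.\<close>

definition diff :: "int \<times> int \<Rightarrow> (int \<times> int \<Rightarrow> int) \<Rightarrow> int \<times> int \<Rightarrow> int" where
  "diff w g u = g (u + w) - g u"

lemma diff_commute: "diff v (diff w g) = diff w (diff v g)"
  by (rule ext) (simp add: diff_def ac_simps)

lemma foldr_diff_commute: "foldr diff ws (diff w g) = diff w (foldr diff ws g)"
  by (induction ws) (simp_all add: diff_commute)

lemma foldr_diff_shift: "foldr diff ws (\<lambda>u. g (u + s)) u = foldr diff ws g (u + s)"
  by (induction ws arbitrary: u) (simp_all add: diff_def ac_simps)

lemma diff_bounded:
  assumes "\<And>u. \<bar>g u\<bar> \<le> B"
  shows "\<bar>diff w g u\<bar> \<le> 2 * B"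
  using assms[of u] assms[of "u + w"] by (simp add: diff_def)

lemma foldr_diff_bounded:
  assumes "\<And>u. \<bar>g u\<bar> \<le> B"
  shows "\<exists>B'. \<forall>u. \<bar>foldr diff ws g u\<bar> \<le> B'"
proof (induction ws)
  case Nil
  then show ?case using assms by auto
next
  case (Cons w ws)
  then obtain B' where "\<And>u. \<bar>foldr diff ws g u\<bar> \<le> B'" by blast
  then have "\<bar>diff w (foldr diff ws g) u\<bar> \<le> 2 * B'" for u by (rule diff_bounded)
  then show ?case by (intro exI[of _ "2 * B'"]) simp
qed

lemma box_op_shift: "box_op r k n (\<lambda>u. g (u + s)) u = box_op r k n g (u + s)"
  by (simp add: box_op_def ac_simps)

lemma box_op_diff: "box_op r k n (diff w g) u = box_op r k n g (u + w) - box_op r k n g u"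
  by (simp add: box_op_def diff_def sum_subtractf ac_simps right_diff_distrib)

lemma box_op_foldr_diff:
  assumes "\<And>u. box_op r k n g u = 0"
  shows "box_op r k n (foldr diff ws g) u = 0"
  using assms by (induction ws arbitrary: u) (simp_all add: box_op_diff)

(* Consecutive equations, one of them shifted, cancel the term of one vector v1 at the price of
   a difference operator on each of the other terms. *)
lemma progression_elimination:
  fixes h :: "int \<times> int \<Rightarrow> int \<times> int \<Rightarrow> int"
  assumes "finite W" "v0 \<notin> W" "M \<noteq> 0"
    and "\<And>j u. (\<Sum>v\<in>insert v0 W. h v (u + scl (int j * M) v)) = 0"
  shows "\<exists>ws. 0 \<notin> set ws \<and> (\<forall>u. foldr diff ws (h v0) u = 0)"
  using assms
proof (induction W arbitrary: h rule: finite_induct)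
  case empty
  from empty.prems(3)[of _ 0] show ?case
    by (intro exI[of _ "[]"]) (simp add: scl_def flip: zero_prod_def)
next
  case (insert v1 W)
  \<comment> \<open>\<open>h' v1\<close> is zero, and every other \<open>h' v\<close> is a translate
    of the difference of \<open>h v\<close> along \<open>scl M (v - v1)\<close>.\<close>
  define h' where "h' v u = h v (u + scl M v) - h v (u + scl M v1)" for v u
  have "(\<Sum>v\<in>insert v0 W. h' v (u + scl (int j * M) v)) = 0" for j u
  proof -
    let ?U = "insert v0 (insert v1 W)"
    have eq: "scl (int (Suc j) * M) v = scl (int j * M) v + scl M v" for v
      by (simp add: scl_def algebra_simps)
    have "0 = (\<Sum>v\<in>?U. h v (u + scl (int (Suc j) * M) v))
      - (\<Sum>v\<in>?U. h v ((u + scl M v1) + scl (int j * M) v))"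
      by (simp only: insert.prems(3))
    also have "\<dots> = (\<Sum>v\<in>?U. h' v (u + scl (int j * M) v))"
      unfolding eq h'_def by (simp only: sum_subtractf ac_simps)
    also have "?U = insert v1 (insert v0 W)" by blast
    also have "(\<Sum>v\<in>\<dots>. h' v (u + scl (int j * M) v))
      = (\<Sum>v\<in>insert v0 W. h' v (u + scl (int j * M) v))"
      using insert.hyps insert.prems(1) by (subst sum.insert) (auto simp: h'_def)
    finally show ?thesis by simp
  qed
  from insert.IH[where h = h', OF _ insert.prems(2) this]
  obtain ws where ws: "0 \<notin> set ws" "\<And>u. foldr diff ws (h' v0) u = 0"
    using insert.prems(1) by blast
  define w where "w = scl M (v0 - v1)"
  have "w \<noteq> 0"
    using insert.prems(1,2) by (auto simp: w_def scl_def prod_eq_iff)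
  have "h' v0 = (\<lambda>u. diff w (h v0) (u + scl M v1))"
    by (rule ext) (simp add: h'_def diff_def w_def scl_def prod_eq_iff algebra_simps plus_prod_def)
  then have "foldr diff ws (diff w (h v0)) (u + scl M v1) = 0" for u
    using ws(2)[of u] by (simp add: foldr_diff_shift)
  from this[of "_ - scl M v1"] have "foldr diff (ws @ [w]) (h v0) u = 0" for u
    by simp
  with ws(1) \<open>w \<noteq> 0\<close> show ?case
    by (intro exI[of _ "ws @ [w]"]) auto
qed

lemma product_of_differences_annihilates:
  assumes B: "\<And>u. \<bar>g u\<bar> \<le> B" and r: "r \<ge> 1"
    and zero: "\<And>u. box_op r k 1 g u = 0"
  shows "\<exists>ws. 0 \<notin> set ws \<and> (\<forall>u. foldr diff ws g u = 0)"
proof -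
  define N where "N = nat ((int (card (king_box r)) + \<bar>k\<bar>) * B) + 2"
  have N: "int N \<ge> (int (card (king_box r)) + \<bar>k\<bar>) * B" "N \<ge> 2"
    by (simp_all add: N_def)
  \<comment> \<open>A nonzero vector is singled out because \<open>h v0\<close> below is then merely
    a translate of \<open>g\<close>.\<close>
  define v0 where "v0 = (int r, int r)"
  have v0: "v0 \<in> king_box r" "v0 \<noteq> 0"
    using r by (auto simp: v0_def king_box_def zero_prod_def)
  have 0: "0 \<in> king_box r - {v0}"
    using v0 by (auto simp: king_box_def zero_prod_def)
  \<comment> \<open>Dilation by \<open>1 + j * fact N\<close> moves by \<open>v\<close> and then by
    \<open>j * fact N\<close> times \<open>v\<close>; the first move is absorbed into
    \<open>h v\<close>. The undilated term \<open>- k * g u\<close> joins the vector 0.\<close>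
  define h where "h v u = (if v = 0 then (1 - k) * g u else g (u + v))" for v u :: "int \<times> int"
  have "(\<Sum>v\<in>insert v0 (king_box r - {v0}). h v (u + scl (int j * fact N) v)) = 0" for j u
  proof -
    define n where "n = 1 + j * fact N"
    have eq: "h v (u + scl (int j * fact N) v) = g (u + scl (int n) v) - (if v = 0 then k * g u else 0)" for v
      by (auto simp: h_def n_def scl_def prod_eq_iff algebra_simps plus_prod_def zero_prod_def)
    have "box_op r k (int n) g u = 0"
      by (rule box_op_dilate[OF B N zero]) (auto simp: n_def dest: prime_dvd_Suc_mult_fact)
    moreover have "(\<Sum>v\<in>king_box r. if v = 0 then k * g u else 0) = k * g u"
      using 0 by (simp add: sum.delta)
    moreover have "insert v0 (king_box r - {v0}) = king_box r" using v0 by blast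
    ultimately show ?thesis
      by (simp add: eq sum_subtractf box_op_def)
  qed
  from progression_elimination[where h = h, OF _ _ _ this]
  obtain ws where ws: "0 \<notin> set ws" "\<And>u. foldr diff ws (h v0) u = 0"
    by auto
  have "h v0 = (\<lambda>u. g (u + v0))" using v0 by (auto simp: h_def)
  with ws(2) have "foldr diff ws g (u + v0) = 0" for u by (simp add: foldr_diff_shift)
  from this[of "_ - v0"] ws(1) show ?thesis by auto
qed

subsection \<open>Eliminating the differences\<close>

definition x_periodic :: "int \<Rightarrow> (int \<times> int \<Rightarrow> int) \<Rightarrow> bool" where
  "x_periodic L g \<longleftrightarrow> (\<forall>u. g (u + (L, 0)) = g u)"

lemma x_periodic_iff_diff: "x_periodic L g \<longleftrightarrow> diff (L, 0) g = (\<lambda>_. 0)"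
  by (auto simp: x_periodic_def diff_def fun_eq_iff)

lemma periodic_mult_nat:
  assumes "\<And>u. e (u + w) = e u"
  shows "e (u + scl (int n) w) = e u"
proof (induction n)
  case 0
  then show ?case by (simp add: scl_def flip: zero_prod_def)
next
  case (Suc n)
  have "u + scl (int (Suc n)) w = (u + scl (int n) w) + w"
    by (simp add: scl_def prod_eq_iff algebra_simps)
  with Suc show ?case using assms by metis
qed

lemma periodic_mult_int:
  assumes "\<And>u. e (u + w) = e u"
  shows "e (u + scl n w) = e u"
proof (cases n)
  case (nonneg m)
  then show ?thesis using periodic_mult_nat[where e = e, OF assms] by simp
next
  case (neg m)
  have "(u + scl n w) + scl (int (Suc m)) w = u"
    unfolding neg by (simp add: scl_def prod_eq_iff algebra_simps)
  then show ?thesis using periodic_mult_nat[of e w "u + scl n w" "Suc m", OF assms] by metis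
qed

lemma x_periodic_mult: assumes "x_periodic L g" shows "x_periodic (n * L) g"
proof -
  have "g (u + scl n (L, 0)) = g u" for u
    by (rule periodic_mult_int) (use assms in \<open>simp only: x_periodic_def\<close>)
  then show ?thesis by (simp only: x_periodic_def) (simp add: scl_def)
qed

(* A bounded function cannot have a nonzero arithmetic progression along a line. *)
lemma bounded_diff_diff_zero:
  assumes B: "\<And>u. \<bar>g u\<bar> \<le> B" and zero: "\<And>u. diff w (diff w g) u = 0"
  shows "diff w g u = 0"
proof (rule ccontr)
  assume nz: "diff w g u \<noteq> 0"
  have per: "diff w g (v + w) = diff w g v" for v using zero[of v] by (simp add: diff_def)
  have lin: "g (u + scl (int n) w) = g u + int n * diff w g u" for n
  proof (induction n)
    case 0
    then show ?case by (simp add: scl_def flip: zero_prod_def)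
  next
    case (Suc n)
    have "g (u + scl (int (Suc n)) w) = g ((u + scl (int n) w) + w)"
      by (rule arg_cong[of _ _ g]) (simp add: scl_def prod_eq_iff algebra_simps)
    also have "\<dots> = g (u + scl (int n) w) + diff w g (u + scl (int n) w)"
      by (simp add: diff_def)
    also have "diff w g (u + scl (int n) w) = diff w g u"
      by (rule periodic_mult_nat) (rule per)
    finally show ?case using Suc by (simp add: algebra_simps)
  qed
  define n where "n = nat (2 * B + 1)"
  have "B \<ge> 0" using B[of 0] by linarith
  have "int n * 1 \<le> int n * \<bar>diff w g u\<bar>" using nz by (intro mult_left_mono) auto
  also have "\<dots> = \<bar>g (u + scl (int n) w) - g u\<bar>" by (simp add: lin abs_mult)
  also have "\<dots> \<le> 2 * B" using B[of u] B[of "u + scl (int n) w"] by linarith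
  finally show False using \<open>B \<ge> 0\<close> by (simp add: n_def)
qed

text \<open>Put \<open>w = (L * L', 0)\<close>. Since differences commute, \<open>diff w g\<close>
  has period \<open>L\<close>, hence \<open>L * L'\<close>. So the second difference along
  \<open>w\<close> vanishes, and boundedness kills the first.\<close>

lemma x_periodic_of_diff:
  assumes B: "\<And>u. \<bar>g u\<bar> \<le> B" and per: "x_periodic L' (diff (L, 0) g)"
  shows "x_periodic (L * L') g"
proof -
  let ?w = "(L * L', 0)"
  have "x_periodic (L * L') (diff (L, 0) g)" using x_periodic_mult[OF per] .
  then have "x_periodic L (diff ?w g)"
    by (simp add: x_periodic_iff_diff diff_commute)
  then have "x_periodic (L * L') (diff ?w g)"
    using x_periodic_mult[of L _ L'] by (simp add: mult.commute)
  then show ?thesis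
    using bounded_diff_diff_zero[where g = g and w = ?w, OF B] unfolding x_periodic_iff_diff by metis
qed

section \<open>Functions with one period: pigeonhole and propagation between parallel lines\<close>

lemma pigeonhole_translates:
  fixes e :: "int \<times> int \<Rightarrow> int"
  assumes "finite K" and B: "\<And>u. \<bar>e u\<bar> \<le> B"
  shows "\<exists>i j :: nat. i < j \<and> (\<forall>u\<in>K. e (u + (int i, 0)) = e (u + (int j, 0)))"
proof -
  define F where "F i = restrict (\<lambda>u. e (u + (int i, 0))) K" for i :: nat
  have "e v \<in> {-B..B}" for v using B[of v] by auto
  then have "range F \<subseteq> K \<rightarrow>\<^sub>E {-B..B}"
    by (auto simp: F_def)
  moreover have "finite (K \<rightarrow>\<^sub>E {-B..B})" using assms(1) by (intro finite_PiE) auto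
  ultimately have "finite (range F)" by (rule finite_subset)
  then have "\<not> inj F" using finite_imageD infinite_UNIV_nat by blast
  then obtain i j where "i \<noteq> j" "F i = F j" by (auto simp: inj_def)
  then obtain i j where ij: "i < j" "F i = F j" by (metis nat_neq_iff)
  have "e (u + (int i, 0)) = e (u + (int j, 0))" if "u \<in> K" for u
    using fun_cong[OF ij(2), of u] that unfolding F_def by (simp only: restrict_apply')
  with ij(1) show ?thesis by blast
qed

text \<open>The determinant of \<open>u\<close> and \<open>w\<close>; for
  \<open>w \<noteq> 0\<close> its level sets lie on lines parallel to \<open>w\<close>.\<close>

definition level :: "int \<times> int \<Rightarrow> int \<times> int \<Rightarrow> int" where
  "level w u = snd w * fst u - fst w * snd u"

lemma level_add: "level w (u + v) = level w u + level w v"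
  and level_diff: "level w (u - v) = level w u - level w v"
  and level_self: "level w w = 0"
  and level_scl: "level w (scl n v) = n * level w v"
  and level_minus: "level w (- v) = - level w v"
  by (simp_all add: level_def scl_def algebra_simps)

text \<open>For moving a translation from one factor of an inner product over a period to the
  other.\<close>

lemma sum_periodic_shift:
  fixes f :: "int \<Rightarrow> int"
  assumes "t > 0" and per: "\<And>y. f (y + t) = f y"
  shows "(\<Sum>y\<in>{0..<t}. f (y + j)) = (\<Sum>y\<in>{0..<t}. f y)"
proof -
  have step: "(\<Sum>y\<in>{0..<t}. f (y + (i + 1))) = (\<Sum>y\<in>{0..<t}. f (y + i))" for i
  proof -
    have "(\<Sum>y\<in>{0..<t}. f (y + (i + 1))) = (\<Sum>y\<in>{1..<t+1}. f (y + i))"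
      by (rule sum.reindex_bij_witness[of _ "\<lambda>y. y - 1" "\<lambda>y. y + 1"]) (auto simp: ac_simps)
    also have "{1..<t+1} = insert t {1..<t}" using assms(1) by auto
    also have "(\<Sum>y\<in>\<dots>. f (y + i)) = f (0 + i) + (\<Sum>y\<in>{1..<t}. f (y + i))"
      using per[of i] by (simp add: ac_simps)
    also have "\<dots> = (\<Sum>y\<in>insert 0 {1..<t}. f (y + i))" by simp
    also have "insert 0 {1..<t} = {0..<t}" using assms(1) by auto
    finally show ?thesis .
  qed
  show ?thesis
  proof (induction j rule: int_induct[where k = 0])
    case base
    then show ?case by simp
  next
    case (step1 i)
    then show ?case using step[of i] by simp
  next
    case (step2 i)
    then show ?case using step[of "i - 1"] by simp
  qed
qed

(* The corner of the square is its unique point of maximal level. *)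
lemma propagate_oblique:
  fixes d :: "int \<times> int \<Rightarrow> int"
  assumes r: "r \<ge> 1" and w: "snd w > 0" "fst w \<noteq> 0"
    and zero: "\<And>u. box_op r k 1 d u = 0"
    and R: "R = int r * (snd w + \<bar>fst w\<bar>)"
    and strip: "\<And>u. m - 2 * R \<le> level w u \<Longrightarrow> level w u < m \<Longrightarrow> d u = 0"
    and u: "level w u = m"
  shows "d u = 0"
proof -
  define q where "q = (int r, - (sgn (fst w) * int r))"
  have q: "q \<in> king_box r" by (auto simp: q_def king_box_def sgn_if)
  have lq: "level w q = R"
    by (auto simp: level_def q_def R algebra_simps sgn_if abs_if)
  have less: "level w v < R" "level w v \<ge> - R" if v: "v \<in> king_box r" "v \<noteq> q" for v
  proof -
    have ab: "\<bar>fst v\<bar> \<le> int r" "\<bar>snd v\<bar> \<le> int r" using v by (auto simp: king_box_def)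
    have 1: "\<bar>snd w * fst v\<bar> \<le> snd w * int r"
      using ab w by (simp add: abs_mult)
    have 2: "\<bar>fst w * snd v\<bar> \<le> \<bar>fst w\<bar> * int r"
      using ab w by (simp add: abs_mult mult_left_mono)
    show "level w v \<ge> - R" using 1 2 unfolding level_def R by (simp add: algebra_simps)
    have "level w v \<le> R" using 1 2 unfolding level_def R by (simp add: algebra_simps)
    moreover have "level w v \<noteq> R"
    proof
      assume "level w v = R"
      \<comment> \<open>Both bounds \<open>1\<close> and \<open>2\<close> must be attained, which
        fixes both coordinates of \<open>v\<close>.\<close>
      then have "snd w * fst v = snd w * int r" "- (fst w * snd v) = \<bar>fst w\<bar> * int r"
        using 1 2 unfolding level_def R by (simp_all add: algebra_simps)
      then have "fst v = int r" "fst w * (snd v + sgn (fst w) * int r) = 0"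
        using w by (simp_all add: distrib_left abs_sgn mult.assoc)
      then have "fst v = int r" "snd v = - (sgn (fst w) * int r)"
        using w by auto
      then show False using v(2) by (simp add: q_def prod_eq_iff)
    qed
    ultimately show "level w v < R" by simp
  qed
  have "R > 0" using r w by (simp add: R)
  \<comment> \<open>The equation is centred at \<open>u - q\<close>, which places \<open>u\<close>
    at the corner. All other points of the square lie on the \<open>2 * R\<close> levels below
    \<open>m\<close>.\<close>
  have vanish: "d (u - q + v) = 0" if "v \<in> king_box r" "v \<noteq> q" for v
    by (rule strip) (use less[OF that] lq u in \<open>auto simp: level_add level_diff\<close>)
  have "d (u - q) = 0"
    by (rule strip) (use lq u \<open>R > 0\<close> in \<open>auto simp: level_diff\<close>)
  moreover have "(\<Sum>v\<in>king_box r. d (u - q + v)) = d (u - q + q)"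
    using q by (subst sum.remove[of _ q]) (auto intro!: sum.neutral vanish)
  moreover have "scl 1 v = v" for v by (simp add: scl_def)
  ultimately show ?thesis using zero[of "u - q"] by (simp add: box_op_def)
qed

(* Let S be the vertical window sum, a self-adjoint operator on t-periodic columns. The equation
   one window to the left shows that S annihilates the column g in question, and the equation
   centred at g shows that k g lies in the image of S; hence g is orthogonal to itself. *)
lemma propagate_vertical:
  fixes d :: "int \<times> int \<Rightarrow> int"
  assumes r: "r \<ge> 1" and k: "k \<noteq> 0" and t: "t > 0"
    and per: "\<And>u. d (u + (0, t)) = d u"
    and zero: "\<And>u. box_op r k 1 d u = 0"
    and strip: "\<And>x y. z - 2 * int r \<le> x \<Longrightarrow> x < z \<Longrightarrow> d (x, y) = 0"
  shows "d (z, y) = 0"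
proof -
  let ?I = "{- int r..int r}"
  have eq: "(\<Sum>i\<in>?I. \<Sum>j\<in>?I. d (x + i, y + j)) = k * d (x, y)" for x y
  proof -
    have "(x, y) + v = (x + fst v, y + snd v)" for v by (simp add: prod_eq_iff)
    then show ?thesis
      using zero[of "(x, y)"] by (simp add: box_op_def king_box_def scl_def sum.cartesian_product
        case_prod_unfold)
  qed
  have win: "(\<Sum>j\<in>?I. d (z, y + j)) = 0" for y
  proof -
    have "(\<Sum>i\<in>?I. \<Sum>j\<in>?I. d ((z - int r) + i, y + j))
       = (\<Sum>j\<in>?I. d ((z - int r) + int r, y + j))"
      by (subst sum.remove[of _ "int r"]) (auto intro!: sum.neutral strip)
    also have "(\<Sum>i\<in>?I. \<Sum>j\<in>?I. d ((z - int r) + i, y + j)) = 0"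
      using r by (simp add: eq strip)
    finally show ?thesis by simp
  qed
  define g where "g y = d (z, y)" for y
  define h where "h y = (\<Sum>i\<in>?I. d (z + i, y))" for y
  have perg: "g (y + t) = g y" and perh: "h (y + t) = h y" for y
    using per[of "(_, y)"] by (simp_all add: g_def h_def)
  have kg: "k * g y = (\<Sum>j\<in>?I. h (y + j))" for y
    unfolding g_def h_def eq[symmetric] by (rule sum.swap)
  have "k * (\<Sum>y\<in>{0..<t}. g y * g y) = (\<Sum>y\<in>{0..<t}. \<Sum>j\<in>?I. h (y + j) * g y)"
    by (simp add: sum_distrib_left sum_distrib_right kg flip: mult.assoc)
  also have "\<dots> = (\<Sum>j\<in>?I. \<Sum>y\<in>{0..<t}. h (y + j) * g y)" by (rule sum.swap)
  also have "\<dots> = (\<Sum>j\<in>?I. \<Sum>y\<in>{0..<t}. h y * g (y - j))"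
  proof (rule sum.cong[OF refl])
    fix j
    have "g (y + t - j) = g (y - j)" for y using perg[of "y - j"] by (simp add: algebra_simps)
    then show "(\<Sum>y\<in>{0..<t}. h (y + j) * g y) = (\<Sum>y\<in>{0..<t}. h y * g (y - j))"
      using sum_periodic_shift[OF t, of "\<lambda>y. h y * g (y - j)" j] perh by simp
  qed
  also have "\<dots> = (\<Sum>y\<in>{0..<t}. \<Sum>j\<in>?I. h y * g (y - j))" by (rule sum.swap)
  also have "\<dots> = (\<Sum>y\<in>{0..<t}. h y * (\<Sum>j\<in>?I. g (y + j)))"
  proof (rule sum.cong[OF refl])
    fix y
    have "(\<Sum>j\<in>?I. h y * g (y - j)) = (\<Sum>j\<in>?I. h y * g (y + j))"
      by (rule sum.reindex_bij_witness[of _ uminus uminus]) auto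
    then show "(\<Sum>j\<in>?I. h y * g (y - j)) = h y * (\<Sum>j\<in>?I. g (y + j))"
      by (simp add: sum_distrib_left)
  qed
  also have "\<dots> = 0" using win by (simp add: g_def)
  finally have "(\<Sum>y\<in>{0..<t}. g y * g y) = 0" using k by simp
  then have all: "g y = 0" if "y \<in> {0..<t}" for y
    using that by (subst (asm) sum_nonneg_eq_0_iff) auto
  have "g y = g (y mod t)"
  proof -
    have "d ((z, y mod t) + scl (y div t) (0, t)) = d (z, y mod t)"
      by (rule periodic_mult_int) (rule per)
    then show ?thesis by (simp add: g_def scl_def)
  qed
  then show ?thesis using all[of "y mod t"] t by (simp add: g_def)
qed

text \<open>For oblique \<open>w\<close> a single point of the square has maximal level. For
  vertical \<open>w\<close> a whole side does, so the argument by columns takes over; there a strip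
  of \<open>2 * R\<close> levels consists of \<open>2 * int r\<close> columns.\<close>

lemma propagate:
  fixes d :: "int \<times> int \<Rightarrow> int"
  assumes r: "r \<ge> 1" and k: "k \<noteq> 0" and w: "snd w > 0"
    and per: "\<And>u. d (u + w) = d u"
    and zero: "\<And>u. box_op r k 1 d u = 0"
    and R: "R = int r * (snd w + \<bar>fst w\<bar>)"
    and strip: "\<And>u. m - 2 * R \<le> level w u \<Longrightarrow> level w u < m \<Longrightarrow> d u = 0"
    and u: "level w u = m"
  shows "d u = 0"
proof (cases "fst w = 0")
  case False
  show ?thesis
    by (rule propagate_oblique[OF r w False zero R strip u])
next
  case True
  define t where "t = snd w"
  have w': "w = (0, t)" using True by (simp add: t_def prod_eq_iff)
  have m: "m = t * fst u" using u w' by (simp add: level_def)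
  have "d (x, y) = 0" if "fst u - 2 * int r \<le> x" "x < fst u" for x y
  proof (rule strip)
    have "t * (fst u - 2 * int r) \<le> t * x" using that w w' by simp
    then show "m - 2 * R \<le> level w (x, y)"
      by (simp add: level_def w' R m algebra_simps)
    show "level w (x, y) < m" using that w w' by (simp add: level_def m)
  qed
  moreover have "t > 0" using w by (simp add: t_def)
  moreover have "d (v + (0, t)) = d v" for v using per[of v] by (simp only: w')
  ultimately have "d (fst u, snd u) = 0"
    by (intro propagate_vertical[where t = t and z = "fst u", OF r k _ _ zero]; blast)
  then show ?thesis by simp
qed

lemma propagate_upwards:
  fixes d :: "int \<times> int \<Rightarrow> int"
  assumes r: "r \<ge> 1" and k: "k \<noteq> 0" and w: "snd w > 0"
    and per: "\<And>u. d (u + w) = d u"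
    and zero: "\<And>u. box_op r k 1 d u = 0"
    and R: "R = int r * (snd w + \<bar>fst w\<bar>)"
    and strip: "\<And>u. m - 2 * R \<le> level w u \<Longrightarrow> level w u < m \<Longrightarrow> d u = 0"
    and u: "m - 2 * R \<le> level w u"
  shows "d u = 0"
proof -
  have all: "\<forall>u. m - 2 * R \<le> level w u \<and> level w u < m + int i \<longrightarrow> d u = 0" for i
  proof (induction i)
    case 0
    then show ?case using strip by simp
  next
    case (Suc i)
    have "d u = 0" if "level w u = m + int i" for u
      by (rule propagate[OF r k w per zero R _ that]) (use Suc in auto)
    with Suc show ?case by (metis add.assoc of_nat_Suc add.commute zle_add1_eq_le order_le_less)
  qed
  from spec[OF all, of u "nat (level w u - m + 1)"] u show ?thesis by simp
qed

text \<open>Reflection through the origin preserves the square and negates levels, which reduces the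
  downward direction to the upward one.\<close>

lemma vanish_from_strip:
  fixes d :: "int \<times> int \<Rightarrow> int"
  assumes r: "r \<ge> 1" and k: "k \<noteq> 0" and w: "snd w > 0"
    and per: "\<And>u. d (u + w) = d u"
    and zero: "\<And>u. box_op r k 1 d u = 0"
    and R: "R = int r * (snd w + \<bar>fst w\<bar>)"
    and strip: "\<And>u. 0 \<le> level w u \<Longrightarrow> level w u < 2 * R \<Longrightarrow> d u = 0"
  shows "d u = 0"
proof (cases "level w u \<ge> 0")
  case True
  show ?thesis
    by (rule propagate_upwards[OF r k w per zero R, of "2 * R"]) (use strip True in auto)
next
  case False
  define d' where "d' v = d (- v)" for v
  have "d' (v + w) = d' v" for v using per[of "- v - w"] by (simp add: d'_def)
  moreover have "box_op r k 1 d' v = 0" for v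
  proof -
    have "(\<Sum>x\<in>king_box r. d (- v - x)) = (\<Sum>x\<in>king_box r. d (- v + x))"
      by (rule sum.reindex_bij_witness[of _ uminus uminus]) (auto simp: king_box_def)
    then show ?thesis using zero[of "- v"] by (simp add: box_op_def d'_def scl_def)
  qed
  \<comment> \<open>The levels from 0 to \<open>2 * R - 1\<close> become those from
    \<open>1 - 2 * R\<close> to 0, so the next level upwards is 1.\<close>
  moreover have "d' v = 0" if "1 - 2 * R \<le> level w v" "level w v < 1" for v
    unfolding d'_def by (rule strip) (use that in \<open>auto simp: level_minus\<close>)
  moreover have "1 - 2 * R \<le> level w (- u)"
  proof -
    have "R \<ge> 0" using w by (simp add: R)
    then show ?thesis using False by (simp add: level_minus)
  qed
  ultimately have "d' (- u) = 0"
    by (rule propagate_upwards[OF r k w _ _ R, of d' 1])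
  then show ?thesis by (simp add: d'_def)
qed

text \<open>The finite set \<open>K\<close> represents a strip modulo \<open>w\<close>. Two
  horizontal translates of \<open>e\<close> that agree on \<open>K\<close> agree on the strip by
  periodicity, hence everywhere by \<open>vanish_from_strip\<close>; their offset is the
  period.\<close>

lemma x_periodic_of_periodic_pos:
  fixes e :: "int \<times> int \<Rightarrow> int"
  assumes r: "r \<ge> 1" and k: "k \<noteq> 0" and w: "snd w > 0"
    and per: "\<And>u. e (u + w) = e u"
    and zero: "\<And>u. box_op r k 1 e u = 0"
    and B: "\<And>u. \<bar>e u\<bar> \<le> B"
  shows "\<exists>L>0. x_periodic L e"
proof -
  define R where "R = int r * (snd w + \<bar>fst w\<bar>)"
  define K where "K = {u. 0 \<le> level w u \<and> level w u < 2 * R \<and> 0 \<le> snd u \<and> snd u < snd w}"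
  have "K \<subseteq> {- (2 * R + \<bar>fst w\<bar> * snd w)..2 * R + \<bar>fst w\<bar> * snd w} \<times> {0..snd w}"
  proof
    fix u assume u: "u \<in> K"
    have "\<bar>fst w * snd u\<bar> \<le> \<bar>fst w\<bar> * snd w"
      using u by (simp add: K_def abs_mult mult_left_mono)
    then have "\<bar>snd w * fst u\<bar> \<le> 2 * R + \<bar>fst w\<bar> * snd w"
      using u unfolding K_def level_def by auto
    moreover have "1 * \<bar>fst u\<bar> \<le> \<bar>snd w * fst u\<bar>"
      unfolding abs_mult by (rule mult_right_mono) (use w in auto)
    ultimately show "u \<in> {- (2 * R + \<bar>fst w\<bar> * snd w)..2 * R + \<bar>fst w\<bar> * snd w} \<times> {0..snd w}"
      using u by (auto simp: K_def mem_Times_iff)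
  qed
  then have "finite K" by (rule finite_subset) simp
  then obtain i j :: nat where ij: "i < j" "\<And>u. u \<in> K \<Longrightarrow> e (u + (int i, 0)) = e (u + (int j, 0))"
    using pigeonhole_translates[where e = e, OF _ B] by metis
  define L where "L = int j - int i"
  define d where "d u = e (u + (int j, 0)) - e (u + (int i, 0))" for u
  have perd: "d (u + w) = d u" for u
    using per[of "u + (int j, 0)"] per[of "u + (int i, 0)"] by (simp add: d_def ac_simps)
  have "d u = 0" for u
  proof (rule vanish_from_strip[where d = d, OF r k w perd _ R_def])
    have "d = (\<lambda>u. diff (L, 0) e (u + (int i, 0)))"
      by (rule ext) (simp add: d_def diff_def L_def ac_simps)
    then show "box_op r k 1 d v = 0" for v
      using box_op_shift[of r k 1 "diff (L, 0) e" "(int i, 0)" v] by (simp add: box_op_diff zero)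
  next
    fix v assume v: "0 \<le> level w v" "level w v < 2 * R"
    \<comment> \<open>Adding a multiple of \<open>w\<close> keeps the level and brings the second
      coordinate into the range of \<open>K\<close>.\<close>
    define v' where "v' = v + scl (- (snd v div snd w)) w"
    have "snd v' = snd v mod snd w"
      by (simp add: v'_def scl_def minus_div_mult_eq_mod)
    then have "v' \<in> K"
      using v w by (simp add: K_def) (simp add: v'_def level_add level_scl level_self)
    then have "d v' = 0" using ij(2) by (simp add: d_def)
    moreover have "d v' = d v" unfolding v'_def by (rule periodic_mult_int) (rule perd)
    ultimately show "d v = 0" by simp
  qed
  then have zd: "d u = 0" for u .
  have "e (u + (L, 0)) = e u" for u
  proof -
    have eq: "u - (int i, 0) + (int j, 0) = u + (L, 0)" by (simp add: L_def prod_eq_iff)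
    show ?thesis using zd[of "u - (int i, 0)"] unfolding d_def eq by simp
  qed
  then have "x_periodic L e" unfolding x_periodic_def by blast
  moreover have "L > 0" using ij(1) by (simp add: L_def)
  ultimately show ?thesis by blast
qed

text \<open>Negating a period orients it upwards, and a horizontal one needs no propagation.\<close>

lemma x_periodic_of_periodic:
  fixes e :: "int \<times> int \<Rightarrow> int"
  assumes r: "r \<ge> 1" and k: "k \<noteq> 0" and w: "w \<noteq> 0"
    and per: "\<And>u. e (u + w) = e u"
    and zero: "\<And>u. box_op r k 1 e u = 0"
    and B: "\<And>u. \<bar>e u\<bar> \<le> B"
  shows "\<exists>L>0. x_periodic L e"
proof -
  have per': "e (u + - w) = e u" for u using per[of "u - w"] by simp
  consider "snd w > 0" | "snd (- w) > 0" | "snd w = 0" by fastforce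
  then show ?thesis
  proof cases
    case 1
    show ?thesis by (rule x_periodic_of_periodic_pos[OF r k 1 per zero B])
  next
    case 2
    show ?thesis by (rule x_periodic_of_periodic_pos[OF r k 2 per' zero B])
  next
    case 3
    then have w': "w = (fst w, 0)" "- w = (- fst w, 0)" by (simp_all add: prod_eq_iff)
    have "x_periodic (fst w) e" "x_periodic (- fst w) e"
      unfolding x_periodic_def w'[symmetric] using per per' by blast+
    moreover have "fst w > 0 \<or> - fst w > 0" using w 3 by (auto simp: prod_eq_iff)
    ultimately show ?thesis by blast
  qed
qed

text \<open>Removing the outermost factor, along \<open>w\<close>, leaves a
  \<open>w\<close>-periodic \<open>e\<close> that still solves the equation, so \<open>e\<close> has
  a horizontal period \<open>L\<close>. Hence the shorter list annihilates
  \<open>diff (L, 0) g\<close>; the induction applies to this function, and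
  \<open>x_periodic_of_diff\<close> returns to \<open>g\<close>.\<close>

lemma x_periodic_of_annihilator:
  fixes g :: "int \<times> int \<Rightarrow> int"
  assumes r: "r \<ge> 1" and k: "k \<noteq> 0"
    and "0 \<notin> set ws" "\<And>u. foldr diff ws g u = 0"
    and "\<And>u. box_op r k 1 g u = 0"
    and "\<And>u. \<bar>g u\<bar> \<le> B"
  shows "\<exists>L>0. x_periodic L g"
  using assms(3-)
proof (induction ws arbitrary: g B)
  case Nil
  then show ?case by (intro exI[of _ 1]) (simp add: x_periodic_def)
next
  case (Cons w ws)
  define e where "e = foldr diff ws g"
  obtain B' where "\<And>u. \<bar>e u\<bar> \<le> B'"
    using foldr_diff_bounded[where g = g, OF Cons.prems(4)] unfolding e_def by blast
  moreover have "box_op r k 1 e u = 0" for u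
    unfolding e_def by (rule box_op_foldr_diff) (rule Cons.prems(3))
  moreover have "e (u + w) = e u" for u
  proof -
    have "diff w e u = 0" using Cons.prems(2)[of u] by (simp add: e_def)
    then show ?thesis by (simp add: diff_def)
  qed
  moreover have "w \<noteq> 0" using Cons.prems(1) by auto
  ultimately have "\<exists>L>0. x_periodic L e"
    by (intro x_periodic_of_periodic[OF r k])
  then obtain L where L: "L > 0" "x_periodic L e" by blast
  have "foldr diff ws (diff (L, 0) g) u = 0" for u
    using L(2) by (simp add: foldr_diff_commute e_def x_periodic_iff_diff)
  moreover have "box_op r k 1 (diff (L, 0) g) u = 0" for u
    by (simp add: box_op_diff Cons.prems(3))
  moreover have "\<bar>diff (L, 0) g u\<bar> \<le> 2 * B" for u
    by (rule diff_bounded) (rule Cons.prems(4))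
  moreover have "0 \<notin> set ws" using Cons.prems(1) by simp
  ultimately have "\<exists>L'>0. x_periodic L' (diff (L, 0) g)"
    by (intro Cons.IH)
  then obtain L' where "L' > 0" "x_periodic L' (diff (L, 0) g)" by blast
  then show ?case
    using x_periodic_of_diff[where g = g, OF Cons.prems(4)] L(1) mult_pos_pos by blast
qed

text \<open>Differencing along \<open>(1, 0)\<close> removes the constant right-hand side, and
  \<open>x_periodic_of_diff\<close> undoes the differencing.\<close>

lemma x_periodic_if_box_op_const:
  fixes c :: "int \<times> int \<Rightarrow> int"
  assumes r: "r \<ge> 1" and k: "k \<noteq> 0"
    and B: "\<And>u. \<bar>c u\<bar> \<le> B" and const: "\<And>u. box_op r k 1 c u = a"
  shows "\<exists>L>0. x_periodic L c"
proof -
  let ?g = "diff (1, 0) c"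
  have zero: "box_op r k 1 ?g u = 0" for u by (simp add: box_op_diff const)
  obtain ws where "0 \<notin> set ws" "\<And>u. foldr diff ws ?g u = 0"
    using product_of_differences_annihilates[OF diff_bounded[OF B] r zero] by blast
  from x_periodic_of_annihilator[OF r k this zero diff_bounded[OF B]]
  obtain L where "L > 0" "x_periodic L ?g" by blast
  then show ?thesis using x_periodic_of_diff[OF B, of L 1] by auto
qed

subsection \<open>Balls of the king grid\<close>

lemma king_awalk_Nil: "pre_digraph.awalk (with_proj king_grid) u [] u"
  by (simp add: pre_digraph.awalk_def pre_digraph.cas.simps) (simp add: king_grid_def)

lemma king_awalk_in_box:
  "pre_digraph.awalk (with_proj king_grid) u p v \<Longrightarrow> v - u \<in> king_box (length p)"
proof (induction p arbitrary: u)
  case Nil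
  then show ?case by (simp add: pre_digraph.awalk_def pre_digraph.cas.simps king_box_def zero_prod_def)
next
  case (Cons e p)
  interpret wf_digraph "with_proj king_grid" by (rule wf_digraph_king_grid)
  from Cons.prems have "e \<in> parcs king_grid" "u = fst e" "awalk (snd e) p v"
    by (auto simp: awalk_Cons_iff)
  then show ?case using Cons.IH[of "snd e"]
    by (auto simp: king_grid_def king_box_def mem_Times_iff)
qed

lemma king_awalk_exists:
  "v - u \<in> king_box n \<Longrightarrow> \<exists>p. pre_digraph.awalk (with_proj king_grid) u p v \<and> length p \<le> n"
proof (induction n arbitrary: u)
  case 0
  then have "u = v" by (auto simp: king_box_def prod_eq_iff)
  then show ?case using king_awalk_Nil by (intro exI[of _ "[]"]) simp
next
  interpret wf_digraph "with_proj king_grid" by (rule wf_digraph_king_grid)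
  case (Suc n)
  show ?case
  proof (cases "u = v")
    case True
    then show ?thesis using king_awalk_Nil by (intro exI[of _ "[]"]) simp
  next
    case False
    \<comment> \<open>The king moves diagonally as long as both coordinates differ.\<close>
    define u' where "u' = u + (sgn (fst (v - u)), sgn (snd (v - u)))"
    have "v - u' \<in> king_box n"
      using Suc.prems by (auto simp: king_box_def u'_def mem_Times_iff sgn_if)
    then obtain p where p: "awalk u' p v" "length p \<le> n" using Suc.IH by blast
    have "(u, u') \<in> parcs king_grid"
      using False by (auto simp: king_grid_def u'_def sgn_if prod_eq_iff zero_prod_def)
    with p show ?thesis by (intro exI[of _ "(u, u') # p"]) (auto simp: awalk_Cons_iff)
  qed
qed

lemma king_nbhd_eq: "king_nbhd r u = (\<lambda>d. u + d) ` king_box r"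
proof -
  interpret wf_digraph "with_proj king_grid" by (rule wf_digraph_king_grid)
  have cost: "awalk_cost (\<lambda>_. 1) p = real (length p)" for p :: "((int \<times> int) \<times> (int \<times> int)) list"
    by (induction p) auto
  have "v \<in> king_nbhd r u \<longleftrightarrow> v - u \<in> king_box r" for v
  proof
    assume "v - u \<in> king_box r"
    then obtain p where p: "awalk u p v" "length p \<le> r" using king_awalk_exists by blast
    then have "\<mu> (\<lambda>_. 1) u v \<le> ereal (real (length p))"
      unfolding \<mu>_def cost by (intro INF_lower) simp
    also have "\<dots> \<le> ereal (real r)" using p by simp
    finally show "v \<in> king_nbhd r u" by (simp add: king_nbhd_def king_dist_def)
  next
    assume "v \<in> king_nbhd r u"
    then have "\<mu> (\<lambda>_. 1) u v \<le> ereal (real r)" by (simp add: king_nbhd_def king_dist_def)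
    \<comment> \<open>A strict bound on the infimum yields an actual walk below it, and integrality
      of its length recovers \<open>r\<close>.\<close>
    also have "\<dots> < ereal (real (Suc r))" by simp
    finally obtain p where p: "awalk u p v" "length p < Suc r"
      unfolding \<mu>_def cost INF_less_iff by auto
    then have "king_box (length p) \<subseteq> king_box r" by (auto simp: king_box_def)
    with king_awalk_in_box[OF p(1)] show "v - u \<in> king_box r" by blast
  qed
  then show ?thesis by (force simp: image_iff algebra_simps)
qed

section \<open>From covering codes to the operator equation\<close>

lemma sum_king_box_indicator:
  "(\<Sum>v\<in>king_box r. if u + v \<in> S then 1 else 0 :: int) = int (card ((\<lambda>d. u + d) ` king_box r \<inter> S))"
proof -
  have "(\<Sum>v\<in>king_box r. if u + v \<in> S then 1 else 0 :: int)
    = (\<Sum>x\<in>(\<lambda>d. u + d) ` king_box r. if x \<in> S then 1 else 0)"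
    by (subst sum.reindex) (auto simp: inj_on_def)
  then show ?thesis by (simp add: sum.If_cases)
qed

text \<open>The count over the square at \<open>u\<close> is \<open>a + (b - a) * c u\<close>, so
  for \<open>k = b - a\<close> the operator sends the indicator \<open>c\<close> to the constant
  \<open>a\<close>. Exchanging the coordinates preserves the square and yields the vertical
  period.\<close>

lemma code_two_periods:
  fixes r a b :: nat and S :: "(int \<times> int) set"
  assumes r: "r \<ge> 1" and ab: "a \<noteq> b"
    and S: "\<And>u. card ((\<lambda>d. u + d) ` king_box r \<inter> S) = (if u \<in> S then b else a)"
  shows "\<exists>p q. lin_indep_pair p q \<and> (\<forall>u. u + p \<in> S \<longleftrightarrow> u \<in> S) \<and> (\<forall>u. u + q \<in> S \<longleftrightarrow> u \<in> S)"
proof -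
  define c :: "int \<times> int \<Rightarrow> int" where "c u = (if u \<in> S then 1 else 0)" for u
  define k where "k = int b - int a"
  have k: "k \<noteq> 0" using ab by (simp add: k_def)
  have B: "\<bar>c u\<bar> \<le> 1" for u by (simp add: c_def)
  have op: "box_op r k 1 c u = int a" for u
    using sum_king_box_indicator[of u S r] S[of u]
    by (simp add: box_op_def c_def scl_def k_def)
  obtain L where L: "L > 0" "x_periodic L c"
    using x_periodic_if_box_op_const[OF r k B op] by blast
  define c' where "c' u = c (prod.swap u)" for u
  have op': "box_op r k 1 c' u = int a" for u
  proof -
    have "prod.swap (u + v) = prod.swap u + prod.swap v" for v :: "int \<times> int"
      by (simp add: prod_eq_iff)
    moreover have "(\<Sum>v\<in>king_box r. c (prod.swap u + prod.swap v)) = (\<Sum>v\<in>king_box r. c (prod.swap u + v))"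
      by (rule sum.reindex_bij_witness[of _ prod.swap prod.swap]) (auto simp: king_box_def)
    ultimately show ?thesis
      using op[of "prod.swap u"] by (simp add: box_op_def scl_def c'_def)
  qed
  have B': "\<bar>c' u\<bar> \<le> 1" for u by (simp add: c'_def B)
  obtain L' where L': "L' > 0" "x_periodic L' c'"
    using x_periodic_if_box_op_const[OF r k B' op'] by blast
  have p: "c (u + (L, 0)) = c u" for u using L(2) unfolding x_periodic_def by blast
  have q: "c (u + (0, L')) = c u" for u
  proof -
    have "c' (prod.swap u + (L', 0)) = c' (prod.swap u)"
      using L'(2) unfolding x_periodic_def by blast
    moreover have "prod.swap (prod.swap u + (L', 0)) = u + (0, L')" by (simp add: prod_eq_iff)
    ultimately show ?thesis by (simp only: c'_def swap_swap)
  qed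
  have mem: "u + w \<in> S \<longleftrightarrow> u \<in> S" if "c (u + w) = c u" for u w
    using that by (auto simp: c_def split: if_splits)
  have "lin_indep_pair (L, 0) (0, L')"
    unfolding lin_indep_pair_def
    using L(1) L'(1) by (auto simp: independent_insert span_singleton zero_prod_def)
  then show ?thesis using mem[OF p] mem[OF q] by blast
qed

theorem theorem11:
  fixes r a b :: nat
  assumes "r \<ge> 1" and "a \<noteq> b"
  shows "(\<forall>c. covering (king_nbhd r 0) b a c \<longrightarrow> two_periodic c) \<and>
         (\<forall>S. king_code_covering r b a S \<longrightarrow> two_periodic_code S)"
proof (intro conjI allI impI)
  fix c assume c: "covering (king_nbhd r 0) b a c"
  define S where "S = {v. c v = 1}"
  have c01: "c u = (if u \<in> S then 1 else 0)" for u
  proof -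
    have "c u \<in> {0, 1}" using c by (simp only: covering_def)
    then show ?thesis by (auto simp: S_def)
  qed
  have "card ((\<lambda>d. u + d) ` king_box r \<inter> S) = (if u \<in> S then b else a)" for u
  proof -
    have "{v \<in> (\<lambda>d. u + d) ` king_nbhd r 0. c v = 1} = (\<lambda>d. u + d) ` king_box r \<inter> S"
      by (auto simp: king_nbhd_eq S_def)
    moreover have "(c u = 1 \<longrightarrow> card {v \<in> (\<lambda>d. u + d) ` king_nbhd r 0. c v = 1} = b) \<and>
        (c u = 0 \<longrightarrow> card {v \<in> (\<lambda>d. u + d) ` king_nbhd r 0. c v = 1} = a)"
      using c unfolding covering_def by blast
    ultimately show ?thesis using c01[of u] by simp
  qed
  from code_two_periods[OF assms this] show "two_periodic c"
    unfolding two_periodic_def c01 by (elim ex_forward) (simp only: simp_thms)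
next
  fix S assume S: "king_code_covering r b a S"
  then have "card ((\<lambda>d. u + d) ` king_box r \<inter> S) = (if u \<in> S then b else a)" for u
    unfolding king_code_covering_def king_nbhd_eq by metis
  from code_two_periods[OF assms this]
  obtain p q where pq: "lin_indep_pair p q" "\<And>u. u + p \<in> S \<longleftrightarrow> u \<in> S" "\<And>u. u + q \<in> S \<longleftrightarrow> u \<in> S"
    by blast
  have "(\<lambda>u. u + w) ` S = S" if "\<And>u. u + w \<in> S \<longleftrightarrow> u \<in> S" for w
  proof
    show "(\<lambda>u. u + w) ` S \<subseteq> S" using that by auto
    show "S \<subseteq> (\<lambda>u. u + w) ` S"
    proof
      fix v assume "v \<in> S"
      then have "v - w \<in> S" using that[of "v - w"] by simp
      then show "v \<in> (\<lambda>u. u + w) ` S" by (intro image_eqI[of _ _ "v - w"]) auto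
    qed
  qed
  then show "two_periodic_code S" unfolding two_periodic_code_def using pq by blast
qed

end
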